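(* Suppose that $\frac{\ell A}{\lambda z_0}\in\mathbb{N}$ and that $$m\le\frac{\delta}{2}\,e^{K^2/2}$$ for some $\delta\in(0,1)$ and $K>0$. Then the coherence of the source-inversion sensing matrix $\mathbf A$ satisfies $$\mu(\mathbf A)\le \frac{\sqrt2\,K}{\sqrt n}$$ with probability (over the sensor ensemble) greater than $(1-\delta)^2$.
   Context: Fix real numbers $z_0,\ell,A,\lambda>0$ and set $\omega=2\pi/\lambda$. Let $m$ be a perfect square. Target grid: $\mathcal{M}=\{\mathbf r_j=(x_j,y_j,z_0): j=1,\dots,m\}$ is a $\sqrt m\times\sqrt m$ square lattice of mesh size $\ell$ in the plane $\{z=z_0\}$. Sensor ensemble: the sensors are $\mathbf a_q=(\xi_q,\eta_q,0)$, $q=1,\dots,n$, where $(\xi_q,\eta_q)$ are i.i.d. uniformly distributed in $[0,A]\times[0,A]$. Source-inversion sensing matrix: the entries are the paraxial Green function $\frac{e^{i\omega z_0}}{4\pi z_0}e^{i\omega|x-\xi|^2/(2z_0)}e^{i\omega|y-\eta|^2/(2z_0)}$ evaluated at sensor/grid-point pairs, normalized so that columns have unit $\ell^2$-norm; i.e. (up to a constant unimodular factor) $\mathbf A\in\mathbb C^{n\times m}$ has entries $$A_{qj}=\frac{1}{\sqrt n}\exp\!\Big(\tfrac{i\omega}{2z_0}\big[(x_j-\xi_q)^2+(y_j-\eta_q)^2\big]\Big).$$ Coherence: for a matrix with columns $c_1,\dots,c_m$, $\mu=\max_{i\ne j}\frac{|c_i^*c_j|}{\|c_i\|_2\|c_j\|_2}$.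 *)

theory Defs
  imports "HOL-Probability.Probability"
begin

text \<open>
  Vectors and matrices over finite index types: \<open>'n\<close> indexes the sensors, \<open>'m\<close> the grid points,
  so the numbers of sensors and grid points are \<open>CARD('n)\<close> and \<open>CARD('m)\<close>.
  Grid points lie in the plane of height \<open>z0\<close> and sensors in the plane of height \<open>0\<close>; only the two
  transverse coordinates are stored.
\<close>

definition cinner :: "complex ^ 'n \<Rightarrow> complex ^ 'n \<Rightarrow> complex"
  where "cinner u v = (\<Sum>q\<in>UNIV. cnj (u $ q) * v $ q)"

text \<open>
  All the quotients are nonnegative, so inserting \<open>0\<close> only matters for a matrix with a single
  column, whose coherence (a maximum over the empty set) is thereby \<open>0\<close>.
\<close>

definition coherence :: "complex ^ 'm ^ 'n \<Rightarrow> real"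
  where "coherence B = Max (insert 0
    {cmod (cinner (column i B) (column j B)) / (norm (column i B) * norm (column j B)) | i j. i \<noteq> j})"

text \<open>
  The points \<open>r j\<close> enumerate, without repetition and in arbitrary order, an axis-parallel
  \<open>s \<times> s\<close> lattice of mesh size \<open>l\<close> with arbitrary corner \<open>(x0, y0)\<close>.
\<close>

definition square_lattice :: "real \<Rightarrow> ('m::finite \<Rightarrow> real \<times> real) \<Rightarrow> bool"
  where "square_lattice l r \<longleftrightarrow>
    (\<exists>s x0 y0. CARD('m) = s\<^sup>2 \<and>
      bij_betw r UNIV {(x0 + real a * l, y0 + real b * l) | a b. a < s \<and> b < s})"

definition paraxial_green :: "real \<Rightarrow> real \<Rightarrow> real \<times> real \<Rightarrow> real \<times> real \<Rightarrow> complex"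
  where "paraxial_green \<omega> z0 p a =
    exp (\<i> * of_real (\<omega> * z0)) / of_real (4 * pi * z0)
      * exp (\<i> * of_real (\<omega> * \<bar>fst p - fst a\<bar>\<^sup>2 / (2 * z0)))
      * exp (\<i> * of_real (\<omega> * \<bar>snd p - snd a\<bar>\<^sup>2 / (2 * z0)))"

definition sensing_matrix ::
    "real \<Rightarrow> real \<Rightarrow> ('m \<Rightarrow> real \<times> real) \<Rightarrow> ('n \<Rightarrow> real \<times> real) \<Rightarrow> complex ^ 'm ^ 'n"
  where "sensing_matrix \<omega> z0 r a = (\<chi> q j.
    of_real (1 / sqrt (real CARD('n))) *
    exp (\<i> * of_real (\<omega> / (2 * z0) *
      ((fst (r j) - fst (a q))\<^sup>2 + (snd (r j) - snd (a q))\<^sup>2))))"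

text \<open>
  The sensing matrix is the matrix of Green function values with columns normalized, up to the
  constant unimodular factor \<open>exp (\<i> * \<omega> * z0)\<close>.
\<close>

lemma norm_column_sensing_matrix:
  "norm (column j (sensing_matrix \<omega> z0 r a :: complex ^ 'm ^ 'n)) = 1"
  by (simp add: norm_vec_def L2_set_def column_def sensing_matrix_def norm_mult norm_divide
      power_divide)

lemma paraxial_green_eq_sensing_matrix:
  assumes "z0 > 0"
  shows "paraxial_green \<omega> z0 (r j) (a q) =
    exp (\<i> * of_real (\<omega> * z0)) * of_real (sqrt (real CARD('n)) / (4 * pi * z0)) *
    (sensing_matrix \<omega> z0 r a :: complex ^ 'm ^ 'n) $ q $ j"
proof -
  have "exp (\<i> * of_real (\<omega> / (2 * z0) * ((fst (r j) - fst (a q))\<^sup>2 + (snd (r j) - snd (a q))\<^sup>2)))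
    = exp (\<i> * of_real (\<omega> * \<bar>fst (r j) - fst (a q)\<bar>\<^sup>2 / (2 * z0)))
      * exp (\<i> * of_real (\<omega> * \<bar>snd (r j) - snd (a q)\<bar>\<^sup>2 / (2 * z0)))"
    unfolding exp_add[symmetric] by (simp add: field_simps add_divide_distrib)
  then show ?thesis
    using assms unfolding paraxial_green_def sensing_matrix_def by (simp add: mult.assoc)
qed

text \<open>
  The \<open>a q\<close> are independent with the uniform distribution on \<open>[0, A]\<^sup>2\<close>; measurability of each
  \<open>a q\<close> is part of \<open>indep_vars\<close>.
\<close>

definition iid_uniform_sensors :: "'w measure \<Rightarrow> real \<Rightarrow> ('n \<Rightarrow> 'w \<Rightarrow> real \<times> real) \<Rightarrow> bool"
  where "iid_uniform_sensors M A a \<longleftrightarrow>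
    prob_space.indep_vars M (\<lambda>_. borel) a UNIV \<and>
    (\<forall>q. distr M borel (a q) = uniform_measure lborel ({0..A} \<times> {0..A}))"

end

theory Submission imports Defs begin

text \<open>
  Up to a constant phase, the inner product of two distinct columns is the mean of the \<open>n\<close>
  independent variables \<open>exp (\<i> U)\<close> with \<open>U = \<beta> \<xi> + \<gamma> \<eta>\<close>. Because \<open>l A / (\<lambda> z0)\<close> is an integer, both
  \<open>\<beta> A\<close> and \<open>\<gamma> A\<close> are multiples of \<open>2 \<pi>\<close>, not both zero, so \<open>U\<close> is uniform modulo \<open>2 \<pi>\<close>.

  The general Hoeffding bound \<open>E exp (t cos U) \<le> exp (t\<^sup>2 / 2)\<close> would be too weak for a union bound over all
  pairs of columns. Averaging over the quarter turns of \<open>U\<close> improves it to \<open>exp (t\<^sup>2 / 4)\<close>, since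
  \<open>(cosh a + cosh b) / 2 \<le> exp ((a\<^sup>2 + b\<^sup>2) / 4)\<close>. Hence the real and imaginary parts of a sum of \<open>n\<close>
  such variables exceed \<open>K \<surd>n\<close> in absolute value with probability at most \<open>4 exp (- K\<^sup>2)\<close>, and the union
  bound over the at most \<open>m\<^sup>2\<close> pairs gives failure probability at most
  \<open>4 m\<^sup>2 exp (- K\<^sup>2) \<le> \<delta>\<^sup>2 < 1 - (1 - \<delta>)\<^sup>2\<close>.
\<close>

section \<open>Exponential inequalities for the four quarter turns of an angle\<close>

text \<open>This is the symmetric case of the estimate behind Hoeffding's lemma: with weight 1/2 and
  length 2x, its left side is ln (cosh x). That estimate is applied for x >= 0; evenness of
  \<open>cosh\<close> covers the rest.\<close>

lemma cosh_le_exp_half_sq: "cosh (x :: real) \<le> exp (x\<^sup>2 / 2)"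
proof -
  have *: "cosh x \<le> exp (x\<^sup>2 / 2)" if "x \<ge> 0" for x :: real
  proof -
    have eq: "1 + 1 / 2 * (exp (2 * x) - 1) = exp x * cosh x"
      by (simp add: cosh_field_def field_simps flip: exp_add)
    have "- (2 * x) * (1 / 2) + ln (1 + 1 / 2 * (exp (2 * x) - 1)) \<le> (2 * x)\<^sup>2 / 8"
      using that by (intro Hoeffdings_lemma_aux) auto
    then have "ln (cosh x) \<le> x\<^sup>2 / 2"
      unfolding eq by (simp add: ln_mult cosh_real_pos power2_eq_square)
    then have "exp (ln (cosh x)) \<le> exp (x\<^sup>2 / 2)"
      by (simp only: exp_le_cancel_iff)
    then show ?thesis
      by (simp add: cosh_real_pos)
  qed
  show ?thesis
    using *[of "\<bar>x\<bar>"] by simp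
qed

lemma cos_add_half_pi: "cos (u + pi / 2) = - sin (u :: real)"
  using minus_sin_cos_eq[of u] by simp

lemma cos_add_three_half_pi: "cos (u + 3 * pi / 2) = sin (u :: real)"
proof -
  have "cos (u + 3 * pi / 2) = cos (u + pi / 2 + pi)"
    by (simp add: algebra_simps)
  then show ?thesis
    by (simp only: cos_periodic_pi cos_add_half_pi minus_minus)
qed

text \<open>The four exponents are a, -b, -a and b, so the sum is 2 (cosh a + cosh b). Bounding each
  \<open>cosh\<close> separately would be too weak: (exp (t^2 / 2) + 1) / 2 exceeds exp (t^2 / 4)
  when b = 0 and t is nonzero. Turning the sum into a product first lets the exponents add up to ((a
  + b)^2 + (a - b)^2) / 8 = t^2 / 4.\<close>

lemma exp_quarter_turns_le:
  fixes t u :: real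
  shows "exp (t * cos u) + exp (t * cos (u + pi / 2)) + exp (t * cos (u + pi))
    + exp (t * cos (u + 3 * pi / 2)) \<le> 4 * exp (t\<^sup>2 / 4)"
proof -
  define a b where "a = t * cos u" and "b = t * sin u"
  have "exp (t * cos u) + exp (t * cos (u + pi / 2)) + exp (t * cos (u + pi))
      + exp (t * cos (u + 3 * pi / 2)) = 2 * (cosh a + cosh b)"
    unfolding cos_add_half_pi cos_add_three_half_pi cos_periodic_pi
    by (simp add: a_def b_def cosh_field_def field_simps)
  also have "\<dots> = 4 * (cosh ((a + b) / 2) * cosh ((a - b) / 2))"
  proof -
    have "a = (a + b) / 2 + (a - b) / 2" "b = (a + b) / 2 - (a - b) / 2"
      by (simp_all add: field_simps)
    then have "cosh a + cosh b = cosh ((a + b) / 2 + (a - b) / 2) + cosh ((a + b) / 2 - (a - b) / 2)"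
      by simp
    then show ?thesis
      by (simp only: cosh_add cosh_diff) simp
  qed
  also have "\<dots> \<le> 4 * (exp (((a + b) / 2)\<^sup>2 / 2) * exp (((a - b) / 2)\<^sup>2 / 2))"
    by (intro mult_left_mono mult_mono cosh_le_exp_half_sq) auto
  also have "\<dots> = 4 * exp ((a\<^sup>2 + b\<^sup>2) / 4)"
    by (simp add: power2_eq_square field_simps flip: exp_add)
  also have "a\<^sup>2 + b\<^sup>2 = t\<^sup>2"
    by (simp add: a_def b_def power_mult_distrib flip: distrib_left)
  finally show ?thesis .
qed

section \<open>Exponential moments of the phase of a uniform sensor\<close>

text \<open>For an antiderivative F on the whole line, F (x + T) - F x has derivative f (x + T) - f
  x = 0. It is therefore constant, and its values at c and 0 are the two integrals.\<close>

lemma integral_periodic_shift: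
  fixes f :: "real \<Rightarrow> real"
  assumes cont: "\<And>x. isCont f x" and per: "\<And>x. f (x + T) = f x" and "T \<ge> 0"
  shows "integral {0..T} (\<lambda>x. f (x + c)) = integral {0..T} f"
proof -
  obtain F where F: "\<And>x. (F has_real_derivative f x) (at x)"
    using einterval_antiderivative[of "-\<infinity>" "\<infinity>" f] cont
    by (auto simp: has_real_derivative_iff_has_vector_derivative)
  have F': "((\<lambda>x. F (x + d)) has_real_derivative f (x + d)) (at x)" for x d
    using F[of "x + d"] by (simp only: DERIV_shift)
  have I: "((\<lambda>x. f (x + d)) has_integral (F (T + d) - F d)) {0..T}" for d
    using fundamental_theorem_of_calculus[of 0 T "\<lambda>x. F (x + d)" "\<lambda>x. f (x + d)"] \<open>T \<ge> 0\<close> F'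
    by (auto simp: has_real_derivative_iff_has_vector_derivative
        intro: has_vector_derivative_at_within)
  have "((\<lambda>x. F (x + T) - F x) has_real_derivative 0) (at x)" for x
    using DERIV_diff[OF F'[of T x] F[of x]] by (simp add: per)
  then have "F (c + T) - F c = F (0 + T) - F 0"
    by (intro DERIV_isconst_all) blast
  then show ?thesis
    using I[of c] I[of 0] by (simp add: add.commute integral_unique)
qed

text \<open>The integrand has period A, and since \<beta> is nonzero, advancing the phase by d is a
  translation by d / \<beta>. Hence all four quarter turns have the same integral, and their sum is
  bounded pointwise by \<open>exp_quarter_turns_le\<close>.\<close>

lemma nn_integral_exp_cos_le:
  fixes A \<beta> c t :: real and k :: int
  assumes "A > 0" "k \<noteq> 0" and \<beta>: "\<beta> * A = 2 * pi * of_int k"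
  shows "(\<integral>\<^sup>+x. ennreal (exp (t * cos (\<beta> * x + c))) * indicator {0..A} x \<partial>lborel)
    \<le> ennreal (A * exp (t\<^sup>2 / 4))"
proof -
  let ?f = "\<lambda>x. exp (t * cos (\<beta> * x + c))"
  have "\<beta> \<noteq> 0"
    using assms by auto
  have per: "?f (x + A) = ?f x" for x
  proof -
    have "\<beta> * (x + A) + c = (\<beta> * x + c) + 2 * pi * of_int k"
      by (simp add: \<beta> distrib_left)
    moreover have "cos (y + 2 * pi * of_int k) = cos y" for y
      by (simp add: cos_add)
    ultimately show ?thesis
      by (simp only:)
  qed
  have int: "(\<lambda>x. exp (t * cos (\<beta> * x + c + d))) integrable_on {0..A}" for d
    by (intro integrable_continuous_interval continuous_intros)
  have shift: "integral {0..A} (\<lambda>x. exp (t * cos (\<beta> * x + c + d))) = integral {0..A} ?f" for d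
  proof -
    have "integral {0..A} (\<lambda>x. ?f (x + d / \<beta>)) = integral {0..A} ?f"
      using assms(1) per by (intro integral_periodic_shift) auto
    moreover have "\<beta> * (x + d / \<beta>) + c = \<beta> * x + c + d" for x
      using \<open>\<beta> \<noteq> 0\<close> by (simp add: field_simps)
    ultimately show ?thesis
      by simp
  qed
  have "4 * integral {0..A} ?f = integral {0..A} (\<lambda>x. exp (t * cos (\<beta> * x + c))
      + exp (t * cos (\<beta> * x + c + pi / 2)) + exp (t * cos (\<beta> * x + c + pi))
      + exp (t * cos (\<beta> * x + c + 3 * pi / 2)))"
    using int[of 0] int[of "pi / 2"] int[of pi] int[of "3 * pi / 2"]
      shift[of "pi / 2"] shift[of pi] shift[of "3 * pi / 2"]
    by (simp add: Henstock_Kurzweil_Integration.integral_add integrable_add)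
  also have "\<dots> \<le> integral {0..A} (\<lambda>x. 4 * exp (t\<^sup>2 / 4))"
    using exp_quarter_turns_le
    by (intro integral_le integrable_continuous_interval continuous_intros) auto
  also have "\<dots> = 4 * (A * exp (t\<^sup>2 / 4))"
    using \<open>A > 0\<close> by simp
  finally have "integral {0..A} ?f \<le> A * exp (t\<^sup>2 / 4)"
    by simp
  moreover have "(\<integral>\<^sup>+x. ennreal (?f x) * indicator {0..A} x \<partial>lborel) = ennreal (integral {0..A} ?f)"
    using int[of 0] by (intro nn_integral_has_integral_lebesgue') auto
  ultimately show ?thesis
    by (simp add: ennreal_leI)
qed

text \<open>Freezing one coordinate only changes the constant phase. By Tonelli, the inner integral
  can be taken over a coordinate with nonzero frequency, where the one-dimensional bound holds
  uniformly in the other. The factor A * A is cancelled by the area of the square.\<close>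

lemma nn_integral_uniform_square_exp_cos_le:
  fixes A \<beta> \<gamma> c t :: real and k k' :: int
  assumes "A > 0" "k \<noteq> 0 \<or> k' \<noteq> 0"
    and \<beta>: "\<beta> * A = 2 * pi * of_int k" and \<gamma>: "\<gamma> * A = 2 * pi * of_int k'"
  shows "(\<integral>\<^sup>+p. ennreal (exp (t * cos (\<beta> * fst p + \<gamma> * snd p + c)))
      \<partial>uniform_measure lborel ({0..A} \<times> {0..A})) \<le> ennreal (exp (t\<^sup>2 / 4))"
proof -
  let ?g = "\<lambda>x y. ennreal (exp (t * cos (\<beta> * x + \<gamma> * y + c)))"
  let ?i = "indicator {0..A} :: real \<Rightarrow> ennreal"
  let ?S = "\<integral>\<^sup>+p. ?g (fst p) (snd p) * indicator ({0..A} \<times> {0..A}) p \<partial>(lborel \<Otimes>\<^sub>M lborel)"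
  have xfirst: "(\<integral>\<^sup>+x. ?g x y * ?i x \<partial>lborel) \<le> ennreal (A * exp (t\<^sup>2 / 4))" if "k \<noteq> 0" for y
    using nn_integral_exp_cos_le[OF \<open>A > 0\<close> that \<beta>, of t "\<gamma> * y + c"] by (simp add: add.assoc)
  have yfirst: "(\<integral>\<^sup>+y. ?g x y * ?i y \<partial>lborel) \<le> ennreal (A * exp (t\<^sup>2 / 4))" if "k' \<noteq> 0" for x
    using nn_integral_exp_cos_le[OF \<open>A > 0\<close> that \<gamma>, of t "\<beta> * x + c"] by (simp add: algebra_simps)
  have const: "(\<integral>\<^sup>+x. ennreal (A * exp (t\<^sup>2 / 4)) * ?i x \<partial>lborel)
      = ennreal (exp (t\<^sup>2 / 4)) * ennreal (A * A)"
    using \<open>A > 0\<close> by (subst nn_integral_cmult) (simp_all add: ennreal_mult mult_ac)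
  have "?S \<le> ennreal (exp (t\<^sup>2 / 4)) * ennreal (A * A)"
  proof (cases "k = 0")
    case False
    have "?S = (\<integral>\<^sup>+y. (\<integral>\<^sup>+x. ?g x y * indicator ({0..A} \<times> {0..A}) (x, y) \<partial>lborel) \<partial>lborel)"
      by (subst lborel_pair.nn_integral_snd[symmetric]) auto
    also have "\<dots> = (\<integral>\<^sup>+y. (\<integral>\<^sup>+x. ?g x y * ?i x \<partial>lborel) * ?i y \<partial>lborel)"
      by (subst nn_integral_multc[symmetric])
        (auto intro!: nn_integral_cong simp: indicator_def)
    also have "\<dots> \<le> (\<integral>\<^sup>+y. ennreal (A * exp (t\<^sup>2 / 4)) * ?i y \<partial>lborel)"
      using xfirst[OF False] by (intro nn_integral_mono mult_right_mono) auto
    finally show ?thesis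
      by (simp only: const)
  next
    case True
    then have "k' \<noteq> 0"
      using assms(2) by simp
    have "?S = (\<integral>\<^sup>+x. (\<integral>\<^sup>+y. ?g x y * indicator ({0..A} \<times> {0..A}) (x, y) \<partial>lborel) \<partial>lborel)"
      by (subst lborel.nn_integral_fst[symmetric]) auto
    also have "\<dots> = (\<integral>\<^sup>+x. (\<integral>\<^sup>+y. ?g x y * ?i y \<partial>lborel) * ?i x \<partial>lborel)"
      by (subst nn_integral_multc[symmetric])
        (auto intro!: nn_integral_cong simp: indicator_def)
    also have "\<dots> \<le> (\<integral>\<^sup>+y. ennreal (A * exp (t\<^sup>2 / 4)) * ?i y \<partial>lborel)"
      using yfirst[OF \<open>k' \<noteq> 0\<close>] by (intro nn_integral_mono mult_right_mono) auto
    finally show ?thesis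
      by (simp only: const)
  qed
  moreover have "emeasure (lborel \<Otimes>\<^sub>M lborel) ({0..A} \<times> {0..A}) = ennreal (A * A)"
    using \<open>A > 0\<close> by (simp add: lborel.emeasure_pair_measure_Times ennreal_mult)
  ultimately show ?thesis
    using \<open>A > 0\<close>
    by (subst nn_integral_uniform_measure)
      (auto simp: lborel_prod[symmetric] intro!: divide_le_posI_ennreal
        simp: mult.commute)
qed


section \<open>Tail bounds for sums over independent sensors\<close>

lemma borel_measurable_sensor_coords:
  fixes a :: "'n::finite \<Rightarrow> 'a \<Rightarrow> real \<times> real"
  assumes "prob_space M" "iid_uniform_sensors M A a"
  shows "(\<lambda>w. fst (a q w)) \<in> borel_measurable M" "(\<lambda>w. snd (a q w)) \<in> borel_measurable M"
proof -
  have "a q \<in> measurable M (borel \<Otimes>\<^sub>M borel)"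
    using assms by (simp add: borel_prod iid_uniform_sensors_def prob_space.indep_vars_def)
  then show "(\<lambda>w. fst (a q w)) \<in> borel_measurable M" "(\<lambda>w. snd (a q w)) \<in> borel_measurable M"
    by measurable
qed

text \<open>Chernoff's method, with independence factoring the exponential moment. The free phase c
  lets this one-sided bound serve both signs of the real and imaginary parts.\<close>

lemma (in prob_space) iid_uniform_sensors_tail:
  fixes a :: "'n::finite \<Rightarrow> 'a \<Rightarrow> real \<times> real"
    and A \<beta> \<gamma> c K :: real and k k' :: int
  assumes iid: "iid_uniform_sensors M A a"
    and "A > 0" "K > 0" "k \<noteq> 0 \<or> k' \<noteq> 0"
    and \<beta>: "\<beta> * A = 2 * pi * of_int k" and \<gamma>: "\<gamma> * A = 2 * pi * of_int k'"
  shows "prob {w \<in> space M. (\<Sum>q\<in>UNIV. cos (\<beta> * fst (a q w) + \<gamma> * snd (a q w) + c))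
      \<ge> K * sqrt (real CARD('n))} \<le> exp (- K\<^sup>2)"
proof -
  have indep: "indep_vars (\<lambda>_. borel) a UNIV"
    and distr: "\<And>q. distr M borel (a q) = uniform_measure lborel ({0..A} \<times> {0..A})"
    using iid by (auto simp: iid_uniform_sensors_def)
  have a_meas: "a q \<in> borel_measurable M" for q
    using indep by (auto simp: indep_vars_def)
  note [measurable] = borel_measurable_sensor_coords[OF prob_space_axioms iid]
  let ?X = "\<lambda>q w. cos (\<beta> * fst (a q w) + \<gamma> * snd (a q w) + c)"
  let ?N = "real CARD('n)"
  \<comment> \<open>This s minimizes the Chernoff exponent n s^2 / 4 - s K sqrt n; the minimum is
    -K^2.\<close>
  define s where "s = 2 * K / sqrt ?N"
  have "s > 0"
    using \<open>K > 0\<close> by (simp add: s_def)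
  have mgf: "(\<integral>\<^sup>+w. ennreal (exp (s * ?X q w)) \<partial>M) \<le> ennreal (exp (s\<^sup>2 / 4))" for q
  proof -
    have "(\<integral>\<^sup>+w. ennreal (exp (s * ?X q w)) \<partial>M) =
        (\<integral>\<^sup>+p. ennreal (exp (s * cos (\<beta> * fst p + \<gamma> * snd p + c))) \<partial>distr M borel (a q))"
      using a_meas by (subst nn_integral_distr) (auto simp: borel_prod[symmetric])
    also have "\<dots> \<le> ennreal (exp (s\<^sup>2 / 4))"
      unfolding distr using assms by (intro nn_integral_uniform_square_exp_cos_le) auto
    finally show ?thesis .
  qed
  have "ennreal (prob {w \<in> space M. (\<Sum>q\<in>UNIV. ?X q w) \<ge> K * sqrt ?N})
      = emeasure M {w \<in> space M. (\<Sum>q\<in>UNIV. ?X q w) \<ge> K * sqrt ?N}"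
    by (simp add: emeasure_eq_measure)
  also have "\<dots> \<le> ennreal (exp (- s * (K * sqrt ?N))) *
      (\<integral>\<^sup>+w\<in>space M. exp (s * (\<Sum>q\<in>UNIV. ?X q w)) \<partial>M)"
    by (intro Chernoff_ineq_nn_integral_ge \<open>s > 0\<close>) auto
  also have "(\<integral>\<^sup>+w\<in>space M. exp (s * (\<Sum>q\<in>UNIV. ?X q w)) \<partial>M)
      = (\<integral>\<^sup>+w. (\<Prod>q\<in>UNIV. ennreal (exp (s * ?X q w))) \<partial>M)"
    by (intro nn_integral_cong) (simp_all add: sum_distrib_left exp_sum prod_ennreal)
  also have "\<dots> = (\<Prod>q\<in>UNIV. \<integral>\<^sup>+w. ennreal (exp (s * ?X q w)) \<partial>M)"
    by (intro indep_vars_nn_integral indep_vars_compose2[OF indep])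
      (auto simp: borel_prod[symmetric])
  also have "ennreal (exp (- s * (K * sqrt ?N))) * \<dots> \<le>
      ennreal (exp (- s * (K * sqrt ?N))) * (\<Prod>q\<in>(UNIV :: 'n set). ennreal (exp (s\<^sup>2 / 4)))"
    using mgf by (intro mult_left_mono prod_mono_ennreal) auto
  also have "\<dots> = ennreal (exp (?N * (s\<^sup>2 / 4) - s * (K * sqrt ?N)))"
  proof -
    have "(\<Prod>q\<in>(UNIV :: 'n set). ennreal (exp (s\<^sup>2 / 4))) = ennreal (exp (?N * (s\<^sup>2 / 4)))"
      by (simp only: prod_constant exp_of_nat_mult ennreal_power exp_ge_zero)
    then show ?thesis
      by (simp flip: ennreal_mult exp_add)
  qed
  also have "?N * (s\<^sup>2 / 4) - s * (K * sqrt ?N) = - K\<^sup>2"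
    by (simp add: s_def power_divide power_mult_distrib power2_eq_square[of K])
  finally show ?thesis
    by simp
qed

text \<open>The four rotated cosine sums are x, -y, -x and y for the complex sum x + iy. If all were
  below B, the sum would lie in a square of half-side B, hence within sqrt 2 * B of the
  origin.\<close>

lemma cmod_gt_imp_quarter_turn_ge:
  fixes \<theta> :: "'n::finite \<Rightarrow> real" and B :: real
  assumes "cmod (\<Sum>q\<in>UNIV. exp (\<i> * of_real (\<theta> q))) > sqrt 2 * B"
  shows "\<exists>d\<in>{0, pi / 2, pi, 3 * pi / 2}. (\<Sum>q\<in>UNIV. cos (\<theta> q + d)) \<ge> B"
proof (rule ccontr)
  assume "\<not> ?thesis"
  then have *: "(\<Sum>q\<in>UNIV. cos (\<theta> q + d)) < B" if "d \<in> {0, pi / 2, pi, 3 * pi / 2}" for d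
    using that by fastforce
  define x y where "x = (\<Sum>q\<in>UNIV. cos (\<theta> q))" and "y = (\<Sum>q\<in>UNIV. sin (\<theta> q))"
  have "x < B" "- y < B" "- x < B" "y < B"
    using *[of 0] *[of "pi / 2"] *[of pi] *[of "3 * pi / 2"]
    by (simp_all add: x_def y_def sum_negf cos_add_half_pi cos_add_three_half_pi)
  \<comment> \<open>Nonnegativity of B is not assumed: it follows from x < B and -x < B.\<close>
  then have "\<bar>x\<bar> \<le> B" "\<bar>y\<bar> \<le> B" "B \<ge> 0"
    by auto
  then have "x\<^sup>2 \<le> B\<^sup>2" "y\<^sup>2 \<le> B\<^sup>2"
    using power_mono[of "\<bar>x\<bar>" B 2] power_mono[of "\<bar>y\<bar>" B 2] by auto
  moreover have "(\<Sum>q\<in>UNIV. exp (\<i> * of_real (\<theta> q))) = Complex x y"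
    by (simp add: x_def y_def complex_eq_iff Re_exp Im_exp)
  ultimately have "cmod (\<Sum>q\<in>UNIV. exp (\<i> * of_real (\<theta> q))) \<le> sqrt (2 * B\<^sup>2)"
    by (simp add: cmod_def)
  with assms \<open>B \<ge> 0\<close> show False
    by (simp add: real_sqrt_mult)
qed

text \<open>Union bound over the four quarter turns, each absorbed into the constant phase as c +
  d.\<close>

lemma (in prob_space) iid_uniform_sensors_cmod_tail:
  fixes a :: "'n::finite \<Rightarrow> 'a \<Rightarrow> real \<times> real"
    and A \<beta> \<gamma> c K :: real and k k' :: int
  assumes iid: "iid_uniform_sensors M A a"
    and "A > 0" "K > 0" "k \<noteq> 0 \<or> k' \<noteq> 0"
    and "\<beta> * A = 2 * pi * of_int k" "\<gamma> * A = 2 * pi * of_int k'"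
  shows "prob {w \<in> space M.
      cmod (\<Sum>q\<in>UNIV. exp (\<i> * of_real (\<beta> * fst (a q w) + \<gamma> * snd (a q w) + c)))
      > sqrt 2 * (K * sqrt (real CARD('n)))} \<le> 4 * exp (- K\<^sup>2)"
proof -
  note [measurable] = borel_measurable_sensor_coords[OF prob_space_axioms iid]
  define D where "D = {0, pi / 2, pi, 3 * pi / 2}"
  have "card D \<le> 4"
    unfolding D_def by (rule order.trans[OF card_insert_le_m1]) (auto simp: card_insert_if)
  have "finite D"
    by (simp add: D_def)
  let ?E = "\<lambda>d. {w \<in> space M. (\<Sum>q\<in>UNIV. cos (\<beta> * fst (a q w) + \<gamma> * snd (a q w) + (c + d)))
      \<ge> K * sqrt (real CARD('n))}"
  have [measurable]: "?E d \<in> events" for d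
    by measurable
  have "prob {w \<in> space M.
      cmod (\<Sum>q\<in>UNIV. exp (\<i> * of_real (\<beta> * fst (a q w) + \<gamma> * snd (a q w) + c)))
      > sqrt 2 * (K * sqrt (real CARD('n)))} \<le> prob (\<Union>d\<in>D. ?E d)"
  proof (rule finite_measure_mono)
    show "(\<Union>d\<in>D. ?E d) \<in> events"
      using \<open>finite D\<close> by (intro sets.finite_UN) auto
    show "{w \<in> space M.
      cmod (\<Sum>q\<in>UNIV. exp (\<i> * of_real (\<beta> * fst (a q w) + \<gamma> * snd (a q w) + c)))
      > sqrt 2 * (K * sqrt (real CARD('n)))} \<subseteq> (\<Union>d\<in>D. ?E d)"
      using cmod_gt_imp_quarter_turn_ge unfolding D_def by (fastforce simp: add.assoc)
  qed
  also have "\<dots> \<le> (\<Sum>d\<in>D. prob (?E d))"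
    using \<open>finite D\<close> by (intro finite_measure_subadditive_finite) auto
  also have "\<dots> \<le> (\<Sum>d\<in>D. exp (- K\<^sup>2))"
    using assms by (intro sum_mono iid_uniform_sensors_tail) auto
  also have "\<dots> \<le> 4 * exp (- K\<^sup>2)"
    using \<open>card D \<le> 4\<close> by simp
  finally show ?thesis .
qed

section \<open>Coherence, column inner products and lattice differences\<close>

text \<open>Nonnegativity of B takes care of the 0 inserted into the maximum, and unit columns
  remove the denominators.\<close>

lemma coherence_le_iff:
  assumes "B \<ge> 0" and "\<And>j. norm (column j M) = 1"
  shows "coherence M \<le> B \<longleftrightarrow> (\<forall>i j. i \<noteq> j \<longrightarrow> cmod (cinner (column i M) (column j M)) \<le> B)"
proof -
  have "finite {cmod (cinner (column i M) (column j M)) / (norm (column i M) * norm (column j M)) | i j. i \<noteq> j}"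
    by (rule finite_subset[of _ "(\<lambda>(i, j). cmod (cinner (column i M) (column j M))
      / (norm (column i M) * norm (column j M))) ` UNIV"]) auto
  then show ?thesis
    using assms unfolding coherence_def by (subst Max_le_iff) auto
qed

text \<open>The squares of the sensor coordinates cancel in the phase difference of two columns.
  What remains is affine in the sensor position, the form required by the tail bounds.\<close>

lemma cinner_column_sensing_matrix:
  fixes r :: "'m::finite \<Rightarrow> real \<times> real" and p :: "'n::finite \<Rightarrow> real \<times> real"
  assumes "z0 \<noteq> 0"
  shows "cinner (column i (sensing_matrix \<omega> z0 r p :: complex ^ 'm ^ 'n)) (column j (sensing_matrix \<omega> z0 r p))
    = (\<Sum>q\<in>UNIV. exp (\<i> * of_real (\<omega> / z0 * (fst (r i) - fst (r j)) * fst (p q)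
        + \<omega> / z0 * (snd (r i) - snd (r j)) * snd (p q)
        + \<omega> / (2 * z0) * ((fst (r j))\<^sup>2 - (fst (r i))\<^sup>2 + (snd (r j))\<^sup>2 - (snd (r i))\<^sup>2))))
      / of_real (real CARD('n))"
proof -
  let ?g = "\<lambda>j q. \<omega> / (2 * z0) * ((fst (r j) - fst (p q))\<^sup>2 + (snd (r j) - snd (p q))\<^sup>2)"
  have phase: "\<omega> / z0 * (fst (r i) - fst (r j)) * fst (p q)
        + \<omega> / z0 * (snd (r i) - snd (r j)) * snd (p q)
        + \<omega> / (2 * z0) * ((fst (r j))\<^sup>2 - (fst (r i))\<^sup>2 + (snd (r j))\<^sup>2 - (snd (r i))\<^sup>2)
      = ?g j q - ?g i q" for q
    using assms by (simp add: field_simps power2_eq_square)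
  have "cnj (complex_of_real (1 / sqrt (real CARD('n))) * exp (\<i> * of_real (?g i q)))
      * (complex_of_real (1 / sqrt (real CARD('n))) * exp (\<i> * of_real (?g j q)))
      = exp (\<i> * of_real (?g j q - ?g i q)) / of_real (real CARD('n))" for q
  proof -
    have "complex_of_real (1 / sqrt (real CARD('n))) * complex_of_real (1 / sqrt (real CARD('n)))
        = 1 / of_real (real CARD('n))"
      unfolding of_real_mult[symmetric] by simp
    moreover have "cnj (exp (\<i> * of_real (?g i q))) * exp (\<i> * of_real (?g j q))
        = exp (\<i> * of_real (?g j q - ?g i q))"
      unfolding exp_cnj exp_add[symmetric] by (simp add: algebra_simps)
    moreover have "cnj (u * z) * (u * z') = (u * u) * (cnj z * z')" if "cnj u = u" for u z z' :: complex
      using that by simp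
    ultimately show ?thesis
      by (simp only: complex_cnj_complex_of_real times_divide_eq_left mult_1_left)
  qed
  then show ?thesis
    unfolding phase cinner_def column_def sensing_matrix_def
    by (simp only: vec_lambda_beta sum_divide_distrib)
qed

text \<open>The lattice corner cancels in differences, and injectivity of r keeps both integers from
  vanishing at once.\<close>

lemma square_lattice_diff:
  assumes "square_lattice l r" "i \<noteq> j"
  obtains k k' :: int where "k \<noteq> 0 \<or> k' \<noteq> 0"
    "fst (r i) - fst (r j) = of_int k * l" "snd (r i) - snd (r j) = of_int k' * l"
proof -
  obtain s x0 y0 where bij: "bij_betw r UNIV {(x0 + real a * l, y0 + real b * l) | a b. a < s \<and> b < s}"
    using assms(1) by (auto simp: square_lattice_def)
  have lat: "\<exists>a b :: nat. r h = (x0 + real a * l, y0 + real b * l)" for h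
    using bij_betwE[OF bij] by fastforce
  obtain a b where i: "r i = (x0 + real a * l, y0 + real b * l)"
    using lat by blast
  obtain a' b' where j: "r j = (x0 + real a' * l, y0 + real b' * l)"
    using lat by blast
  have "r i \<noteq> r j"
    using bij assms(2) by (auto simp: bij_betw_def inj_def)
  then have "int a - int a' \<noteq> 0 \<or> int b - int b' \<noteq> 0"
    by (auto simp: i j)
  then show thesis
    by (rule that) (simp_all add: i j algebra_simps)
qed

section \<open>Union bound over pairs of columns\<close>

theorem theorem3:
  fixes z0 l A lam \<delta> K :: real
    and r :: "'m::finite \<Rightarrow> real \<times> real"
    and M :: "'w measure"
    and a :: "'n::finite \<Rightarrow> 'w \<Rightarrow> real \<times> real"
  assumes "z0 > 0" and "l > 0" and "A > 0" and "lam > 0"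
    and "square_lattice l r"
    and "prob_space M" and "iid_uniform_sensors M A a"
    and "l * A / (lam * z0) \<in> \<nat>"
    and "0 < \<delta>" and "\<delta> < 1" and "K > 0"
    and "real CARD('m) \<le> \<delta> / 2 * exp (K\<^sup>2 / 2)"
  shows "measure M {w \<in> space M.
      coherence (sensing_matrix (2 * pi / lam) z0 r (\<lambda>q. a q w) :: complex ^ 'm ^ 'n)
        \<le> sqrt 2 * K / sqrt (real CARD('n))} > (1 - \<delta>)\<^sup>2"
proof -
  interpret prob_space M
    by fact
  note [measurable] = borel_measurable_sensor_coords[OF prob_space_axioms assms(7)]
  let ?\<omega> = "2 * pi / lam"
  let ?N = "real CARD('n)" and ?m = "real CARD('m)"
  let ?S = "\<lambda>w. sensing_matrix ?\<omega> z0 r (\<lambda>q. a q w) :: complex ^ 'm ^ 'n"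
  define \<beta> where "\<beta> i j = ?\<omega> / z0 * (fst (r i) - fst (r j))" for i j
  define \<gamma> where "\<gamma> i j = ?\<omega> / z0 * (snd (r i) - snd (r j))" for i j
  define c where
    "c i j = ?\<omega> / (2 * z0) * ((fst (r j))\<^sup>2 - (fst (r i))\<^sup>2 + (snd (r j))\<^sup>2 - (snd (r i))\<^sup>2)" for i j
  define Bad where "Bad i j = {w \<in> space M.
      cmod (\<Sum>q\<in>UNIV. exp (\<i> * of_real (\<beta> i j * fst (a q w) + \<gamma> i j * snd (a q w) + c i j)))
      > sqrt 2 * (K * sqrt ?N)}" for i j
  \<comment> \<open>Ordered pairs count each pair of columns twice; the decay exp (-K^2) can absorb
    the crude count m^2.\<close>
  define I where "I = {p :: 'm \<times> 'm. fst p \<noteq> snd p}"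
  have Bad_events: "Bad i j \<in> events" for i j
    unfolding Bad_def by measurable

  obtain N where N: "l * A / (lam * z0) = real N"
    using assms(8) by (auto elim: Nats_cases)
  \<comment> \<open>The naturals include 0, which positivity of l and A excludes; otherwise both
    frequencies would vanish.\<close>
  have "N > 0"
    using N assms(1-4) by (cases N) auto
  have tail: "prob (Bad i j) \<le> 4 * exp (- K\<^sup>2)" if "i \<noteq> j" for i j
  proof -
    obtain k k' :: int where k: "k \<noteq> 0 \<or> k' \<noteq> 0"
      and x: "fst (r i) - fst (r j) = of_int k * l" and y: "snd (r i) - snd (r j) = of_int k' * l"
      using square_lattice_diff[OF assms(5) \<open>i \<noteq> j\<close>] .
    \<comment> \<open>Here integrality of l A / (lam z0) enters: every lattice difference gives a
      frequency completing whole periods across the aperture.\<close>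
    have period: "?\<omega> / z0 * (of_int h * l) * A = 2 * pi * of_int (h * int N)" for h :: int
    proof -
      have "?\<omega> / z0 * (of_int h * l) * A = 2 * pi * of_int h * (l * A / (lam * z0))"
        by simp
      then show ?thesis
        unfolding N by simp
    qed
    show ?thesis
      unfolding Bad_def
    proof (rule iid_uniform_sensors_cmod_tail[OF assms(7,3,11)])
      show "k * int N \<noteq> 0 \<or> k' * int N \<noteq> 0"
        using k \<open>N > 0\<close> by simp
    qed (simp_all only: \<beta>_def \<gamma>_def x y period)
  qed

  have cinner_le: "cmod (cinner (column i (?S w)) (column j (?S w))) \<le> sqrt 2 * K / sqrt ?N
      \<longleftrightarrow> w \<notin> Bad i j" if "w \<in> space M" for i j w
  proof -
    \<comment> \<open>The inner product is the phase sum divided by n, so the threshold is rewritten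
      over n to compare numerators.\<close>
    have "sqrt 2 * K / sqrt ?N = sqrt 2 * (K * sqrt ?N) / ?N"
      by (simp add: field_simps)
    moreover have "cmod (z / of_real ?N) = cmod z / ?N" for z
      by (simp add: norm_divide)
    ultimately show ?thesis
      using that assms(1) unfolding Bad_def \<beta>_def \<gamma>_def c_def
      by (simp only: cinner_column_sensing_matrix divide_le_cancel) auto
  qed
  have good: "{w \<in> space M. coherence (?S w) \<le> sqrt 2 * K / sqrt ?N} = space M - (\<Union>(i, j)\<in>I. Bad i j)"
  proof (intro set_eqI)
    fix w
    have "coherence (?S w) \<le> sqrt 2 * K / sqrt ?N \<longleftrightarrow> (\<forall>i j. i \<noteq> j \<longrightarrow> w \<notin> Bad i j)"
      if "w \<in> space M"
      using assms(11) cinner_le[OF that]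
      by (subst coherence_le_iff) (auto simp: norm_column_sensing_matrix)
    then show "w \<in> {w \<in> space M. coherence (?S w) \<le> sqrt 2 * K / sqrt ?N}
        \<longleftrightarrow> w \<in> space M - (\<Union>(i, j)\<in>I. Bad i j)"
      unfolding I_def by fastforce
  qed
  have "?m\<^sup>2 \<le> (\<delta> / 2 * exp (K\<^sup>2 / 2))\<^sup>2"
    using assms(12) by (intro power_mono) auto
  also have "\<dots> = \<delta>\<^sup>2 / 4 * exp (K\<^sup>2)"
    by (simp add: power_mult_distrib power_divide flip: exp_double)
  \<comment> \<open>The 1/4 from squaring \<delta> / 2 cancels the 4 of the tail bound.\<close>
  finally have count: "?m\<^sup>2 * (4 * exp (- K\<^sup>2)) \<le> \<delta>\<^sup>2"
    by (simp add: exp_minus field_simps)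
  have "card I \<le> card (UNIV :: ('m \<times> 'm) set)"
    by (rule card_mono) auto
  then have cardI: "real (card I) \<le> ?m\<^sup>2"
    by (simp add: power2_eq_square card_prod flip: of_nat_mult)

  have "prob (\<Union>(i, j)\<in>I. Bad i j) \<le> (\<Sum>(i, j)\<in>I. prob (Bad i j))"
    unfolding case_prod_unfold using Bad_events by (intro finite_measure_subadditive_finite) auto
  also have "\<dots> \<le> (\<Sum>_\<in>I. 4 * exp (- K\<^sup>2))"
    using tail by (intro sum_mono) (auto simp: I_def)
  also have "\<dots> \<le> ?m\<^sup>2 * (4 * exp (- K\<^sup>2))"
    unfolding sum_constant using cardI by (intro mult_right_mono) auto
  also have "\<dots> \<le> \<delta>\<^sup>2"
    by (rule count)
  \<comment> \<open>The strictness of the final bound comes from this gap 2 \<delta> (1 -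
    \<delta>).\<close>
  also have "\<delta>\<^sup>2 < 1 - (1 - \<delta>)\<^sup>2"
  proof -
    have "1 - (1 - \<delta>)\<^sup>2 - \<delta>\<^sup>2 = 2 * (\<delta> * (1 - \<delta>))"
      by (simp add: power2_eq_square algebra_simps)
    moreover have "\<delta> * (1 - \<delta>) > 0"
      using assms(9,10) by simp
    ultimately show ?thesis
      by linarith
  qed
  finally have "prob (\<Union>(i, j)\<in>I. Bad i j) < 1 - (1 - \<delta>)\<^sup>2" .
  moreover have "(\<Union>(i, j)\<in>I. Bad i j) \<in> events"
    using Bad_events by (intro sets.finite_UN) auto
  ultimately show ?thesis
    unfolding good by (simp add: prob_compl)
qed

end
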